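(* The following hold. (i) For every NTS $\Sigma$ and every positive integer $K$: if $\Sigma$ is infinite-step opaque then it is $K$-step opaque, current-state opaque and initial-state opaque; and if $\Sigma$ is $K$-step opaque then it is current-state opaque. (ii) There exists an NTS that is current-state opaque but not initial-state opaque; there exist a positive integer $K$ and an NTS that is current-state opaque but not $K$-step opaque; there exists an NTS that is current-state opaque but not infinite-step opaque. (iii) There exist a positive integer $K$ and an NTS that is $K$-step opaque but not infinite-step opaque; there exist a positive integer $K$ and an NTS that is $K$-step opaque but not initial-state opaque. (iv) There exists an NTS that is initial-state opaque but not current-state opaque; there exist a positive integer $K$ and an NTS that is initial-state opaque but not $K$-step opaque; there exists an NTS that is initial-state opaque but not infinite-step opaque.
   Context: A nondeterministic transition system (NTS) is a tuple $\Sigma=(X,X_0,S,U,\to,Y,h)$, where $X$ is a (possibly infinite) set of states, $X_0\subseteq X$ the initial states, $S\subseteq X$ the secret states, $U$ a (possibly infinite) set of inputs, $\to\subseteq X\times U\times X$ the transition relation, $Y$ a set of outputs and $h:X\to Y$ the output map. $U^*$ is the set of finite sequences $\alpha=\alpha(0)\cdots\alpha(|\alpha|-1)$ over $U$, including the empty one. For $\alpha\in U^*$, a run over $\alpha$ is a nonempty sequence of states $x_0x_1\dots x_k$ with $k\le|\alpha|$, $x_0\in X_0$ and $(x_j,\alpha(j),x_{j+1})\in\to$ for all $j\in\{0,\dots,k-1\}$; it is maximal if $k=|\alpha|$ or there is no $x'$ with $(x_k,\alpha(k),x')\in\to$. Initial-state opaque: for every $\alpha\in U^*$ and every maximal run $x_0\dots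 x_k$ over $\alpha$ with $x_0\in X_0\cap S$, there is a maximal run $x_0'\dots x_k'$ over $\alpha$ with $x_0'\notin S$ and $h(x_j)=h(x_j')$ for all $j\in\{0,\dots,k\}$. Current-state opaque: for every $\alpha\in U^*$ and every run $x_0\dots x_{|\alpha|}$ over $\alpha$ with $x_{|\alpha|}\in S$ there is a run $x_0'\dots x_{|\alpha|}'$ over $\alpha$ with $x'_{|\alpha|}\notin S$ and $h(x_j)=h(x_j')$ for all $j\in\{0,\dots,|\alpha|\}$. $K$-step opaque ($K$ a positive integer): for every $\alpha\in U^*$, every run $x_0\dots x_{|\alpha|}$ over $\alpha$ and every $i$ with $\max\{0,|\alpha|-K\}\le i\le|\alpha|$ and $x_i\in S$, there is a run $x_0'\dots x'_{|\alpha|}$ over $\alpha$ with $x_i'\notin S$ and $h(x_j)=h(x_j')$ for all $j\in\{0,\dots,|\alpha|\}$. Infinite-step opaque: for every $\alpha\in U^*$, every maximal run $x_0\dots x_k$ over $\alpha$ and every $i\in\{0,\dots,k\}$ with $x_i\in S$, there is a maximal run $x_0'\dots x_k'$ over $\alpha$ with $x_i'\notin S$ and $h(x_j)=h(x_j')$ for all $j\in\{0,\dots,k\}$. *)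

theory Defs
  imports Main "HOL-Library.FuncSet"
begin

record ('x, 'u, 'y) nts =
  states :: "'x set"
  init :: "'x set"
  secret :: "'x set"
  inputs :: "'u set"
  transitions :: "('x \<times> 'u \<times> 'x) set"
  outputs :: "'y set"
  out :: "'x \<Rightarrow> 'y"

definition is_nts :: "('x, 'u, 'y) nts \<Rightarrow> bool" where
  "is_nts \<Sigma> \<longleftrightarrow>
     init \<Sigma> \<subseteq> states \<Sigma> \<and>
     secret \<Sigma> \<subseteq> states \<Sigma> \<and>
     transitions \<Sigma> \<subseteq> states \<Sigma> \<times> inputs \<Sigma> \<times> states \<Sigma> \<and>
     out \<Sigma> \<in> states \<Sigma> \<rightarrow> outputs \<Sigma>"

text \<open>A state sequence $x_0 \dots x_k$ is a list of length $k + 1$, so $k \le |\alpha|$ reads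
  \<open>length xs \<le> length \<alpha> + 1\<close>.\<close>

definition is_run :: "('x, 'u, 'y) nts \<Rightarrow> 'u list \<Rightarrow> 'x list \<Rightarrow> bool" where
  "is_run \<Sigma> \<alpha> xs \<longleftrightarrow>
     xs \<noteq> [] \<and>
     xs \<in> lists (states \<Sigma>) \<and>
     length xs \<le> length \<alpha> + 1 \<and>
     xs ! 0 \<in> init \<Sigma> \<and>
     (\<forall>j. j + 1 < length xs \<longrightarrow> (xs ! j, \<alpha> ! j, xs ! (j + 1)) \<in> transitions \<Sigma>)"

definition maximal_run :: "('x, 'u, 'y) nts \<Rightarrow> 'u list \<Rightarrow> 'x list \<Rightarrow> bool" where
  "maximal_run \<Sigma> \<alpha> xs \<longleftrightarrow>
     is_run \<Sigma> \<alpha> xs \<and>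
     (length xs = length \<alpha> + 1 \<or>
      \<not> (\<exists>x'. (last xs, \<alpha> ! (length xs - 1), x') \<in> transitions \<Sigma>))"

definition same_outputs :: "('x, 'u, 'y) nts \<Rightarrow> 'x list \<Rightarrow> 'x list \<Rightarrow> bool" where
  "same_outputs \<Sigma> xs xs' \<longleftrightarrow>
     length xs' = length xs \<and> (\<forall>j < length xs. out \<Sigma> (xs ! j) = out \<Sigma> (xs' ! j))"

definition initial_state_opaque :: "('x, 'u, 'y) nts \<Rightarrow> bool" where
  "initial_state_opaque \<Sigma> \<longleftrightarrow>
     (\<forall>\<alpha> \<in> lists (inputs \<Sigma>). \<forall>xs.
        maximal_run \<Sigma> \<alpha> xs \<and> xs ! 0 \<in> init \<Sigma> \<inter> secret \<Sigma> \<longrightarrow>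
        (\<exists>xs'. maximal_run \<Sigma> \<alpha> xs' \<and> xs' ! 0 \<notin> secret \<Sigma> \<and> same_outputs \<Sigma> xs xs'))"

definition current_state_opaque :: "('x, 'u, 'y) nts \<Rightarrow> bool" where
  "current_state_opaque \<Sigma> \<longleftrightarrow>
     (\<forall>\<alpha> \<in> lists (inputs \<Sigma>). \<forall>xs.
        is_run \<Sigma> \<alpha> xs \<and> length xs = length \<alpha> + 1 \<and> xs ! length \<alpha> \<in> secret \<Sigma> \<longrightarrow>
        (\<exists>xs'. is_run \<Sigma> \<alpha> xs' \<and> xs' ! length \<alpha> \<notin> secret \<Sigma> \<and> same_outputs \<Sigma> xs xs'))"

text \<open>Truncated subtraction on \<^typ>\<open>nat\<close> makes \<open>length \<alpha> - K\<close> equal to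
  $\max\{0, |\alpha| - K\}$.\<close>

definition K_step_opaque :: "nat \<Rightarrow> ('x, 'u, 'y) nts \<Rightarrow> bool" where
  "K_step_opaque K \<Sigma> \<longleftrightarrow>
     (\<forall>\<alpha> \<in> lists (inputs \<Sigma>). \<forall>xs. \<forall>i.
        is_run \<Sigma> \<alpha> xs \<and> length xs = length \<alpha> + 1 \<and>
        length \<alpha> - K \<le> i \<and> i \<le> length \<alpha> \<and> xs ! i \<in> secret \<Sigma> \<longrightarrow>
        (\<exists>xs'. is_run \<Sigma> \<alpha> xs' \<and> xs' ! i \<notin> secret \<Sigma> \<and> same_outputs \<Sigma> xs xs'))"

definition infinite_step_opaque :: "('x, 'u, 'y) nts \<Rightarrow> bool" where
  "infinite_step_opaque \<Sigma> \<longleftrightarrow>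
     (\<forall>\<alpha> \<in> lists (inputs \<Sigma>). \<forall>xs. \<forall>i.
        maximal_run \<Sigma> \<alpha> xs \<and> i < length xs \<and> xs ! i \<in> secret \<Sigma> \<longrightarrow>
        (\<exists>xs'. maximal_run \<Sigma> \<alpha> xs' \<and> xs' ! i \<notin> secret \<Sigma> \<and> same_outputs \<Sigma> xs xs'))"

end

theory Submission
  imports Defs
begin

text \<open>The positive implications hold because a run of full length is maximal. For the separations in
  (ii) and (iii), take the path 0, 1, 2 with initial states 0 and 1, secret 0 and constant output:
  the secret start 0 is masked by the start 1 for as long as at most one step is made, but the run
  0, 1, 2 has no other run of the same length. For (iv), take a secret that is entered only after the
  first step.\<close>

lemma infinite_step_opaque_imp_K_step_opaque:
  assumes "infinite_step_opaque \<Sigma>"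
  shows "K_step_opaque K \<Sigma>"
  unfolding K_step_opaque_def
proof (intro ballI allI impI, elim conjE)
  fix \<alpha> xs i
  assume "\<alpha> \<in> lists (inputs \<Sigma>)" "is_run \<Sigma> \<alpha> xs" "length xs = length \<alpha> + 1"
    "i \<le> length \<alpha>" "xs ! i \<in> secret \<Sigma>"
  then obtain xs' where "maximal_run \<Sigma> \<alpha> xs'" "xs' ! i \<notin> secret \<Sigma>" "same_outputs \<Sigma> xs xs'"
    using assms unfolding infinite_step_opaque_def
    by (metis le_imp_less_Suc Suc_eq_plus1 maximal_run_def)
  then show "\<exists>xs'. is_run \<Sigma> \<alpha> xs' \<and> xs' ! i \<notin> secret \<Sigma> \<and> same_outputs \<Sigma> xs xs'"
    by (auto simp: maximal_run_def)
qed

text \<open>Take \<open>i = length \<alpha>\<close>, which lies in the window for every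
  \<open>K\<close>.\<close>

lemma K_step_opaque_imp_current_state_opaque:
  "K_step_opaque K \<Sigma> \<Longrightarrow> current_state_opaque \<Sigma>"
  unfolding K_step_opaque_def current_state_opaque_def by (metis diff_le_self order_refl)

text \<open>Take \<open>i = 0\<close>; this is a valid position because a run is nonempty.\<close>

lemma infinite_step_opaque_imp_initial_state_opaque:
  assumes "infinite_step_opaque \<Sigma>"
  shows "initial_state_opaque \<Sigma>"
  using assms unfolding infinite_step_opaque_def initial_state_opaque_def
  by (metis IntD2 is_run_def length_greater_0_conv maximal_run_def)

text \<open>The constant output reduces \<open>same_outputs\<close> to equality of lengths, so only
  the number of states in a run can reveal where it started.\<close>

definition path_nts :: "(nat, nat, nat) nts" where
  "path_nts = \<lparr>states = {0, 1, 2}, init = {0, 1}, secret = {0}, inputs = {0},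
     transitions = {(0, 0, 1), (1, 0, 2)}, outputs = {0}, out = (\<lambda>_. 0)\<rparr>"

lemma is_nts_path_nts: "is_nts path_nts"
  by (simp add: is_nts_def path_nts_def)

text \<open>Every transition raises the state by one, so a run is determined by its start and its
  length.\<close>

lemma path_nts_run_nth:
  assumes "is_run path_nts \<alpha> xs" "j < length xs"
  shows "xs ! j = xs ! 0 + j"
  using assms(2)
proof (induction j)
  case (Suc j)
  with assms(1) have "xs ! Suc j = Suc (xs ! j)"
    by (auto simp: is_run_def path_nts_def)
  with Suc show ?case by simp
qed simp

text \<open>The last state is the start plus \<open>length xs - 1\<close>, and no state exceeds 2.
  The bound is what rules out a run of three states from the nonsecret start 1.\<close>

lemma path_nts_run_start_add_length:
  assumes "is_run path_nts \<alpha> xs"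
  shows "xs ! 0 + length xs \<le> 3"
proof -
  from assms have "xs \<noteq> []" "set xs \<subseteq> {0, 1, 2}"
    by (auto simp: is_run_def path_nts_def)
  then have "xs ! (length xs - 1) \<in> {0, 1, 2}"
    by (meson diff_less length_greater_0_conv nth_mem subsetD zero_less_one)
  then have "xs ! (length xs - 1) \<le> 2"
    by auto
  with path_nts_run_nth[OF assms, of "length xs - 1"] \<open>xs \<noteq> []\<close> show ?thesis
    by (cases xs) auto
qed

lemma path_nts_1_step_opaque: "K_step_opaque 1 path_nts"
  unfolding K_step_opaque_def
proof (intro ballI allI impI, elim conjE)
  fix \<alpha> xs i
  assume \<alpha>: "\<alpha> \<in> lists (inputs path_nts)" and run: "is_run path_nts \<alpha> xs"
    and len: "length xs = length \<alpha> + 1" and i: "length \<alpha> - 1 \<le> i" "i \<le> length \<alpha>"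
    and "xs ! i \<in> secret path_nts"
  \<comment> \<open>States increase along a run, so the secret 0 can occur only at the first
    position.\<close>
  then have "i = 0"
    using path_nts_run_nth[OF run, of i] by (simp add: path_nts_def)
  \<comment> \<open>With \<open>K = 1\<close>, the window contains position 0 only for words of
    length at most one.\<close>
  with i consider "\<alpha> = []" | a where "\<alpha> = [a]"
    by (cases \<alpha>) auto
  then show "\<exists>xs'. is_run path_nts \<alpha> xs' \<and> xs' ! i \<notin> secret path_nts \<and> same_outputs path_nts xs xs'"
  proof cases
    case 1
    \<comment> \<open>In both cases the mask is the run of the required length from the nonsecret
      start 1.\<close>
    with \<open>i = 0\<close> len show ?thesis
      by (intro exI[of _ "[1]"]) (simp add: is_run_def path_nts_def same_outputs_def)
  next
    case 2
    with \<open>i = 0\<close> len \<alpha> show ?thesis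
      by (intro exI[of _ "[1, 2]"]) (simp add: is_run_def path_nts_def same_outputs_def)
  qed
qed

lemma path_nts_full_run: "is_run path_nts [0, 0] [0, 1, 2]"
  by (simp add: is_run_def path_nts_def less_Suc_eq all_conj_distrib numeral_2_eq_2)

lemma path_nts_run_length_3:
  "is_run path_nts \<alpha> xs \<Longrightarrow> length xs = 3 \<Longrightarrow> xs ! 0 = 0"
  using path_nts_run_start_add_length by fastforce

text \<open>The run \<open>[0, 1, 2]\<close> uses up the whole word \<open>[0, 0]\<close> and is
  therefore maximal; every run with as many states also starts in the secret.\<close>

lemma path_nts_not_initial_state_opaque: "\<not> initial_state_opaque path_nts"
proof
  assume "initial_state_opaque path_nts"
  moreover have "maximal_run path_nts [0, 0] [0, 1, 2]"
    using path_nts_full_run by (simp add: maximal_run_def)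
  moreover have "[0, 0] \<in> lists (inputs path_nts)" "[0, 1, 2] ! 0 \<in> init path_nts \<inter> secret path_nts"
    by (simp_all add: path_nts_def)
  ultimately obtain xs where "is_run path_nts [0, 0] xs" "xs ! 0 \<notin> secret path_nts"
    "same_outputs path_nts [0, 1, 2] xs"
    unfolding initial_state_opaque_def maximal_run_def by blast
  then show False
    using path_nts_run_length_3[of "[0, 0]" xs] by (simp add: path_nts_def same_outputs_def)
qed

text \<open>For \<open>K = 2\<close> and a word of length two the window reaches back to position 0,
  so the run \<open>[0, 1, 2]\<close> is again a counterexample.\<close>

lemma path_nts_not_2_step_opaque: "\<not> K_step_opaque 2 path_nts"
proof
  assume "K_step_opaque 2 path_nts"
  moreover have "[0, 0] \<in> lists (inputs path_nts)" "[0, 1, 2] ! 0 \<in> secret path_nts"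
    "length [0::nat, 1, 2] = length [0::nat, 0] + 1" "length [0::nat, 0] - 2 \<le> 0" "0 \<le> length [0::nat, 0]"
    by (simp_all add: path_nts_def)
  ultimately obtain xs where "is_run path_nts [0, 0] xs" "xs ! 0 \<notin> secret path_nts"
    "same_outputs path_nts [0, 1, 2] xs"
    unfolding K_step_opaque_def using path_nts_full_run by blast
  then show False
    using path_nts_run_length_3[of "[0, 0]" xs] by (simp add: path_nts_def same_outputs_def)
qed

definition late_secret_nts :: "(nat, nat, nat) nts" where
  "late_secret_nts = \<lparr>states = {0, 1}, init = {0}, secret = {1}, inputs = {0},
     transitions = {(0, 0, 1)}, outputs = {0}, out = (\<lambda>_. 0)\<rparr>"

lemma is_nts_late_secret_nts: "is_nts late_secret_nts"
  by (simp add: is_nts_def late_secret_nts_def)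

text \<open>No initial state is secret, so the condition is vacuous.\<close>

lemma late_secret_nts_initial_state_opaque: "initial_state_opaque late_secret_nts"
  by (simp add: initial_state_opaque_def late_secret_nts_def)

text \<open>Over the word \<open>[0]\<close> the only run with two states is \<open>[0, 1]\<close>,
  which ends in the secret.\<close>

lemma late_secret_nts_not_current_state_opaque: "\<not> current_state_opaque late_secret_nts"
proof
  assume "current_state_opaque late_secret_nts"
  moreover have "is_run late_secret_nts [0] [0, 1]" "[0] \<in> lists (inputs late_secret_nts)"
    "length [0::nat, 1] = length [0::nat] + 1" "[0, 1] ! length [0::nat] \<in> secret late_secret_nts"
    by (simp_all add: is_run_def late_secret_nts_def)
  ultimately obtain xs where "is_run late_secret_nts [0] xs" "xs ! 1 \<notin> secret late_secret_nts"
    "same_outputs late_secret_nts [0, 1] xs"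
    unfolding current_state_opaque_def by fastforce
  then show False
    by (auto simp: is_run_def late_secret_nts_def same_outputs_def)
qed

theorem theorem4p1:
  shows
    "(\<forall>(\<Sigma> :: ('x, 'u, 'y) nts) (K :: nat). is_nts \<Sigma> \<and> K > 0 \<longrightarrow>
        (infinite_step_opaque \<Sigma> \<longrightarrow>
           K_step_opaque K \<Sigma> \<and> current_state_opaque \<Sigma> \<and> initial_state_opaque \<Sigma>) \<and>
        (K_step_opaque K \<Sigma> \<longrightarrow> current_state_opaque \<Sigma>))
     \<and>
     ((\<exists>\<Sigma> :: (nat, nat, nat) nts.
         is_nts \<Sigma> \<and> current_state_opaque \<Sigma> \<and> \<not> initial_state_opaque \<Sigma>) \<and>
      (\<exists>(K :: nat) (\<Sigma> :: (nat, nat, nat) nts).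
         K > 0 \<and> is_nts \<Sigma> \<and> current_state_opaque \<Sigma> \<and> \<not> K_step_opaque K \<Sigma>) \<and>
      (\<exists>\<Sigma> :: (nat, nat, nat) nts.
         is_nts \<Sigma> \<and> current_state_opaque \<Sigma> \<and> \<not> infinite_step_opaque \<Sigma>))
     \<and>
     ((\<exists>(K :: nat) (\<Sigma> :: (nat, nat, nat) nts).
         K > 0 \<and> is_nts \<Sigma> \<and> K_step_opaque K \<Sigma> \<and> \<not> infinite_step_opaque \<Sigma>) \<and>
      (\<exists>(K :: nat) (\<Sigma> :: (nat, nat, nat) nts).
         K > 0 \<and> is_nts \<Sigma> \<and> K_step_opaque K \<Sigma> \<and> \<not> initial_state_opaque \<Sigma>))
     \<and>
     ((\<exists>\<Sigma> :: (nat, nat, nat) nts.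
         is_nts \<Sigma> \<and> initial_state_opaque \<Sigma> \<and> \<not> current_state_opaque \<Sigma>) \<and>
      (\<exists>(K :: nat) (\<Sigma> :: (nat, nat, nat) nts).
         K > 0 \<and> is_nts \<Sigma> \<and> initial_state_opaque \<Sigma> \<and> \<not> K_step_opaque K \<Sigma>) \<and>
      (\<exists>\<Sigma> :: (nat, nat, nat) nts.
         is_nts \<Sigma> \<and> initial_state_opaque \<Sigma> \<and> \<not> infinite_step_opaque \<Sigma>))"
proof -
  note implications = infinite_step_opaque_imp_K_step_opaque
    K_step_opaque_imp_current_state_opaque infinite_step_opaque_imp_initial_state_opaque
  have path: "current_state_opaque path_nts" "\<not> infinite_step_opaque path_nts"
    using path_nts_1_step_opaque path_nts_not_initial_state_opaque implications by blast+
  \<comment> \<open>Either property would imply current-state opacity.\<close>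
  have late_secret: "\<not> K_step_opaque 1 late_secret_nts" "\<not> infinite_step_opaque late_secret_nts"
    using late_secret_nts_not_current_state_opaque implications by blast+
  \<comment> \<open>The existential claims about \<open>K\<close> use 2 for the failure of
    \<open>K\<close>-step opacity in \<open>path_nts\<close> and 1 elsewhere.\<close>
  have pos: "(0::nat) < 1" "(0::nat) < 2"
    by simp_all
  show ?thesis
    by (intro conjI allI impI;
        use implications pos path late_secret is_nts_path_nts is_nts_late_secret_nts
          path_nts_1_step_opaque path_nts_not_2_step_opaque path_nts_not_initial_state_opaque
          late_secret_nts_initial_state_opaque late_secret_nts_not_current_state_opaque in blast)
qed

end
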